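(* Let $p$ be a prime, and let $m, n_1,\dots,n_m$ be positive integers such that $n_1+\cdots+n_m\ge (p-1)n$. Let $A_1,\dots,A_m\subseteq \mathbb{F}_p^n$ be sets such that for each $1\le i\le m$, $A_i$ is not contained in the zero set of any nonzero polynomial in $\mathbb{F}_p[X_1,\dots,X_n]$ of degree $\le n_i$. Then \[ A_1+\cdots+A_m=\mathbb{F}_p^n. \]
   Context: For sets $A_1,\dots,A_m$ in an abelian group, $A_1+\cdots+A_m=\{a_1+\cdots+a_m : a_i\in A_i\}$. *)

theory Defs
  imports
    "HOL-Analysis.Finite_Cartesian_Product"
    "HOL-Library.Poly_Mapping"
    "HOL-Library.Set_Algebras"
    "Berlekamp_Zassenhaus.Finite_Field"
begin

text \<open>A formal polynomial over \<open>'a\<close> in variables indexed by \<open>'n\<close> is a finitely supported map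
  from monomials to coefficients; a monomial is the finitely supported map giving the exponent
  of each variable. Distinct formal polynomials may induce the same function on points:
  the polynomial $X^p - X$ is nonzero over the field with $p$ elements.\<close>

type_synonym ('n, 'a) mpoly = "('n \<Rightarrow>\<^sub>0 nat) \<Rightarrow>\<^sub>0 'a"

definition mpoly_eval :: "('n::finite, 'a::comm_semiring_1) mpoly \<Rightarrow> 'a ^ 'n \<Rightarrow> 'a" where
  "mpoly_eval P x =
     (\<Sum>\<alpha>\<in>Poly_Mapping.keys P.
        Poly_Mapping.lookup P \<alpha> * (\<Prod>j\<in>UNIV. (x $ j) ^ Poly_Mapping.lookup \<alpha> j))"

text \<open>Total degree, with the zero polynomial given degree \<open>0\<close>.\<close>

definition mpoly_degree :: "('n::finite, 'a::zero) mpoly \<Rightarrow> nat" where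
  "mpoly_degree P =
     Max (insert 0 ((\<lambda>\<alpha>. \<Sum>j\<in>UNIV. Poly_Mapping.lookup \<alpha> j) ` Poly_Mapping.keys P))"

definition zero_set :: "('n::finite, 'a::comm_semiring_1) mpoly \<Rightarrow> ('a ^ 'n) set" where
  "zero_set P = {x. mpoly_eval P x = 0}"

end

theory Submission
  imports Defs "Berlekamp_Zassenhaus.Berlekamp_Type_Based"
begin

text \<open>
  By duality, nondegeneracy of \<open>A i\<close> in degree \<open>d i\<close> yields, for every exponent \<open>\<alpha>\<close> of total
  degree \<open>d i\<close>, weights on \<open>A i\<close> that sum \<open>x\<^sup>\<alpha>\<close> to \<open>1\<close> and every other monomial of degree at most
  \<open>d i\<close> to \<open>0\<close>. Averaging the translates \<open>g (x + a)\<close>, \<open>a \<in> A i\<close>, against these weights acts on top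
  degree terms like the divided derivative of order \<open>\<alpha>\<close>: it lowers degrees by \<open>d i\<close> and sends
  \<open>x\<^sup>\<gamma>\<close> to \<open>binom \<gamma> \<alpha> \<cdot> x\<^sup>\<gamma>\<^sup>-\<^sup>\<alpha>\<close> plus terms of lower degree, where \<open>binom \<gamma> \<alpha>\<close> is nonzero modulo \<open>p\<close>
  as long as all entries of \<open>\<gamma>\<close> are below \<open>p\<close>. The indicator function of the origin is
  \<open>\<Prod>\<^sub>j (1 - x\<^sub>j\<^sup>p\<^sup>-\<^sup>1)\<close>, of degree \<open>(p - 1) n\<close>, so the successive averages over \<open>A 1, \<dots>, A m\<close> turn it
  into a nonzero constant. Hence every translate of \<open>A 1 + \<dots> + A m\<close> contains the origin.
\<close>

no_notation vec_index (infixl "$" 100)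

section \<open>Duality\<close>

text \<open>The Fredholm alternative for rows \<open>M a\<close> and target \<open>e\<close>, by
  adding one row at a time. Only a separating \<open>w\<close> that pairs nontrivially with the new
  row needs work.\<close>

lemma finite_linear_alternative:
  fixes M :: "'i \<Rightarrow> 'b \<Rightarrow> 'a::field"
  assumes "finite A" and "finite B"
  shows "(\<exists>c. \<forall>\<beta>\<in>B. (\<Sum>a\<in>A. c a * M a \<beta>) = e \<beta>) \<or>
         (\<exists>w. (\<forall>a\<in>A. (\<Sum>\<beta>\<in>B. M a \<beta> * w \<beta>) = 0) \<and> (\<Sum>\<beta>\<in>B. e \<beta> * w \<beta>) \<noteq> 0)"
  using assms(1)
proof (induction A arbitrary: e rule: finite_induct)
  case empty
  show ?case
  proof (cases "\<forall>\<beta>\<in>B. e \<beta> = 0")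
    case False
    then obtain \<beta> where \<beta>: "\<beta> \<in> B" "e \<beta> \<noteq> 0" by blast
    have "(\<Sum>\<beta>'\<in>B. e \<beta>' * (if \<beta>' = \<beta> then 1 else 0)) = (\<Sum>\<beta>'\<in>B. if \<beta>' = \<beta> then e \<beta>' else 0)"
      by (intro sum.cong) auto
    also have "\<dots> = e \<beta>"
      using assms(2) \<beta> by simp
    finally show ?thesis
      using \<beta> by (intro disjI2 exI[of _ "\<lambda>\<beta>'. if \<beta>' = \<beta> then 1 else 0"]) simp
  qed auto
next
  case (insert b A)
  let ?ip = "\<lambda>u w. \<Sum>\<beta>\<in>B. u \<beta> * w \<beta> :: 'a"
  consider (span) c where "\<forall>\<beta>\<in>B. (\<Sum>a\<in>A. c a * M a \<beta>) = e \<beta>"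
    | (sep) w where "\<forall>a\<in>A. ?ip (M a) w = 0" "?ip e w \<noteq> 0"
    using insert.IH[of e] by blast
  then show ?case
  proof cases
    case span
    have "(\<Sum>a\<in>insert b A. (c(b := 0)) a * M a \<beta>) = e \<beta>" if "\<beta> \<in> B" for \<beta>
    proof -
      have "(\<Sum>a\<in>A. (c(b := 0)) a * M a \<beta>) = (\<Sum>a\<in>A. c a * M a \<beta>)"
        using insert.hyps by (intro sum.cong) auto
      then show ?thesis using span that insert.hyps by simp
    qed
    then show ?thesis by blast
  next
    case sep
    show ?thesis
    proof (cases "?ip (M b) w = 0")
      case True
      then show ?thesis using sep by blast
    next
      case False
      \<comment> \<open>This multiple of the row \<open>M b\<close> makes \<open>e'\<close>
        orthogonal to \<open>w\<close>.\<close>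
      define r where "r = ?ip e w / ?ip (M b) w"
      define e' where "e' = (\<lambda>\<beta>. e \<beta> - r * M b \<beta>)"
      consider (span') c where "\<forall>\<beta>\<in>B. (\<Sum>a\<in>A. c a * M a \<beta>) = e' \<beta>"
        | (sep') w' where "\<forall>a\<in>A. ?ip (M a) w' = 0" "?ip e' w' \<noteq> 0"
        using insert.IH[of e'] by blast
      then show ?thesis
      proof cases
        case span'
        have "(\<Sum>a\<in>insert b A. (c(b := r)) a * M a \<beta>) = e \<beta>" if "\<beta> \<in> B" for \<beta>
        proof -
          have "(\<Sum>a\<in>A. (c(b := r)) a * M a \<beta>) = (\<Sum>a\<in>A. c a * M a \<beta>)"
            using insert.hyps by (intro sum.cong) auto
          then show ?thesis using span' that insert.hyps by (simp add: e'_def)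
        qed
        then show ?thesis by blast
      next
        case sep'
        \<comment> \<open>Correcting \<open>w'\<close> by this multiple of \<open>w\<close> makes it
          orthogonal to \<open>M b\<close> as well; by the choice of \<open>r\<close>, its pairing
          with \<open>e\<close> is that of \<open>w'\<close> with \<open>e'\<close>.\<close>
        define s where "s = ?ip (M b) w' / ?ip (M b) w"
        define w'' where "w'' = (\<lambda>\<beta>. w' \<beta> - s * w \<beta>)"
        have ip: "?ip u w'' = ?ip u w' - s * ?ip u w" for u
          by (simp add: w''_def algebra_simps sum_subtractf sum_distrib_left)
        have "?ip e' w' = ?ip e w' - r * ?ip (M b) w'"
          by (simp add: e'_def algebra_simps sum_subtractf sum_distrib_left)
        also have "\<dots> = ?ip e w''"
          by (simp add: ip r_def s_def)
        finally have "?ip e w'' \<noteq> 0" using sep' by simp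
        moreover have "?ip (M a) w'' = 0" if "a \<in> insert b A" for a
          using that sep sep' False by (auto simp: ip s_def)
        ultimately show ?thesis by blast
      qed
    qed
  qed
qed

section \<open>Monomial functions\<close>

definition monomial_fun :: "('n::finite \<Rightarrow> nat) \<Rightarrow> 'a::comm_semiring_1 ^ 'n \<Rightarrow> 'a" where
  "monomial_fun \<beta> x = (\<Prod>j\<in>UNIV. (x $ j) ^ \<beta> j)"

lemma finite_exponents_le:
  "finite {\<beta> :: 'n::finite \<Rightarrow> nat. sum \<beta> UNIV \<le> d}"
proof (rule finite_subset)
  show "{\<beta> :: 'n \<Rightarrow> nat. sum \<beta> UNIV \<le> d} \<subseteq> PiE UNIV (\<lambda>_. {..d})"
    by (auto intro: order_trans[OF member_le_sum[of _ UNIV]])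
  show "finite (PiE (UNIV :: 'n set) (\<lambda>_. {..d}))"
    by (intro finite_PiE) auto
qed

lemma sum_diff_exponent:
  fixes \<beta> \<gamma> :: "'n::finite \<Rightarrow> nat"
  assumes "\<beta> \<in> PiE UNIV (\<lambda>j. {..\<gamma> j})"
  shows "(\<Sum>j\<in>UNIV. \<gamma> j - \<beta> j) = sum \<gamma> UNIV - sum \<beta> UNIV" "sum \<beta> UNIV \<le> sum \<gamma> UNIV"
  using assms by (auto intro!: sum_subtractf_nat sum_mono simp: PiE_iff)

text \<open>The binomial theorem in each coordinate, with the product then distributed over the
  sums.\<close>

lemma monomial_fun_add:
  "monomial_fun \<gamma> (x + y) =
     (\<Sum>\<beta>\<in>PiE UNIV (\<lambda>j. {..\<gamma> j}). of_nat (\<Prod>j\<in>UNIV. \<gamma> j choose \<beta> j) *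
        monomial_fun \<beta> y * monomial_fun (\<lambda>j. \<gamma> j - \<beta> j) x)"
proof -
  have "monomial_fun \<gamma> (x + y) =
      (\<Prod>j\<in>UNIV. \<Sum>k\<le>\<gamma> j. of_nat (\<gamma> j choose k) * (y $ j) ^ k * (x $ j) ^ (\<gamma> j - k))"
    unfolding monomial_fun_def by (simp add: add.commute[of x y] binomial_ring)
  also have "\<dots> = (\<Sum>\<beta>\<in>PiE UNIV (\<lambda>j. {..\<gamma> j}).
      \<Prod>j\<in>UNIV. of_nat (\<gamma> j choose \<beta> j) * (y $ j) ^ \<beta> j * (x $ j) ^ (\<gamma> j - \<beta> j))"
    by (rule prod_sum_PiE) auto
  finally show ?thesis
    by (simp add: monomial_fun_def prod.distrib)
qed

text \<open>Since the bound is strict, \<open>low_degree 0\<close> contains only the zero function.\<close>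

inductive_set low_degree :: "nat \<Rightarrow> ('a::comm_ring_1 ^ 'n::finite \<Rightarrow> 'a) set" for k where
  zero: "(\<lambda>x. 0) \<in> low_degree k"
| add_monomial: "f \<in> low_degree k \<Longrightarrow> sum \<beta> UNIV < k \<Longrightarrow>
    (\<lambda>x. r * monomial_fun \<beta> x + f x) \<in> low_degree k"

lemma low_degree_0: "f \<in> low_degree 0 \<Longrightarrow> f x = 0"
  by (induction rule: low_degree.induct) auto

lemma low_degree_add:
  "f \<in> low_degree k \<Longrightarrow> g \<in> low_degree k \<Longrightarrow> (\<lambda>x. f x + g x) \<in> low_degree k"
  by (induction rule: low_degree.induct) (auto simp: add.assoc intro: low_degree.add_monomial)

lemma low_degree_cmult:
  "f \<in> low_degree k \<Longrightarrow> (\<lambda>x. r * f x) \<in> low_degree k"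
proof (induction rule: low_degree.induct)
  case (add_monomial f \<beta> s)
  then show ?case
    using low_degree.add_monomial[of "\<lambda>x. r * f x" k \<beta> "r * s"]
    by (simp add: algebra_simps)
qed (auto intro: low_degree.zero)

lemma low_degree_monomial:
  "sum \<beta> UNIV < k \<Longrightarrow> (\<lambda>x. r * monomial_fun \<beta> x) \<in> low_degree k"
  using low_degree.add_monomial[OF low_degree.zero, of \<beta> k r] by simp

lemma low_degree_sum:
  "(\<And>i. i \<in> I \<Longrightarrow> f i \<in> low_degree k) \<Longrightarrow> (\<lambda>x. \<Sum>i\<in>I. f i x) \<in> low_degree k"
  by (induction I rule: infinite_finite_induct) (auto intro: low_degree.zero low_degree_add)

section \<open>Weighted averages over a nondegenerate set\<close>

text \<open>Since \<open>P\<close> is formal, over the field with \<open>p\<close> elements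
  \<open>X^p - X\<close> rules out every set once \<open>d\<close> reaches \<open>p\<close>.\<close>

definition nondegenerate :: "('a::comm_ring_1 ^ 'n::finite) set \<Rightarrow> nat \<Rightarrow> bool" where
  "nondegenerate A d \<longleftrightarrow>
     \<not> (\<exists>P :: ('n, 'a) mpoly. P \<noteq> 0 \<and> mpoly_degree P \<le> d \<and> A \<subseteq> zero_set P)"

lemma nondegenerate_mono: "nondegenerate A d \<Longrightarrow> d' \<le> d \<Longrightarrow> nondegenerate A d'"
  unfolding nondegenerate_def using order_trans by blast

text \<open>The numbers \<open>w \<beta>\<close> are the coefficients of a polynomial of degree at
  most \<open>d\<close> vanishing on \<open>A\<close>, which must be the zero polynomial.\<close>

lemma nondegenerate_combination_eq_0:
  fixes A :: "('a::comm_ring_1 ^ 'n::finite) set"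
  assumes "nondegenerate A d"
    and "\<And>a. a \<in> A \<Longrightarrow> (\<Sum>\<beta> | sum \<beta> UNIV \<le> d. monomial_fun \<beta> a * w \<beta>) = 0"
    and "sum \<beta> UNIV \<le> d"
  shows "w \<beta> = 0"
proof (rule ccontr)
  assume nz: "w \<beta> \<noteq> 0"
  define B where "B = {\<beta> :: 'n \<Rightarrow> nat. sum \<beta> UNIV \<le> d}"
  define h where "h \<alpha> = (if Poly_Mapping.lookup \<alpha> \<in> B then w (Poly_Mapping.lookup \<alpha>) else 0)"
    for \<alpha> :: "'n \<Rightarrow>\<^sub>0 nat"
  define P where "P = Abs_poly_mapping h"
  \<comment> \<open>With finitely many variables every exponent function has finite support, so
    plain functions and formal monomials correspond bijectively.\<close>
  have lookup_Abs: "Poly_Mapping.lookup (Abs_poly_mapping \<beta>) = \<beta>" for \<beta> :: "'n \<Rightarrow> nat"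
    by (simp add: Abs_poly_mapping_inverse)
  have inj: "inj_on Poly_Mapping.lookup S" for S :: "('n \<Rightarrow>\<^sub>0 nat) set"
    by (simp add: inj_on_def)
  have finB: "finite B"
    unfolding B_def by (rule finite_exponents_le)
  have fin: "finite {\<alpha>. Poly_Mapping.lookup \<alpha> \<in> B}"
    using finite_vimageI[OF finB inj] by (simp add: vimage_def)
  have "finite {\<alpha>. h \<alpha> \<noteq> 0}"
    by (rule finite_subset[OF _ fin]) (auto simp: h_def split: if_splits)
  then have lookup_P: "Poly_Mapping.lookup P = h"
    by (simp add: P_def)
  have keys_P: "Poly_Mapping.keys P = {\<alpha>. h \<alpha> \<noteq> 0}"
    by (simp add: keys.rep_eq lookup_P)
  then have keys_sub: "Poly_Mapping.keys P \<subseteq> {\<alpha>. Poly_Mapping.lookup \<alpha> \<in> B}"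
    by (auto simp: h_def split: if_splits)
  have "h (Abs_poly_mapping \<beta>) \<noteq> 0"
    using nz assms(3) by (simp add: h_def lookup_Abs B_def)
  then have "P \<noteq> 0"
    using lookup_P by auto
  moreover have "mpoly_degree P \<le> d"
    unfolding mpoly_degree_def using keys_sub by (auto simp: B_def)
  moreover have "A \<subseteq> zero_set P"
  proof
    fix a assume "a \<in> A"
    have "mpoly_eval P a =
        (\<Sum>\<alpha>\<in>Poly_Mapping.keys P. h \<alpha> * monomial_fun (Poly_Mapping.lookup \<alpha>) a)"
      by (simp add: mpoly_eval_def lookup_P monomial_fun_def)
    also have "\<dots> =
        (\<Sum>\<alpha> | Poly_Mapping.lookup \<alpha> \<in> B. h \<alpha> * monomial_fun (Poly_Mapping.lookup \<alpha>) a)"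
      by (rule sum.mono_neutral_left[OF fin keys_sub]) (auto simp: keys_P)
    also have "\<dots> = (\<Sum>\<beta>\<in>B. monomial_fun \<beta> a * w \<beta>)"
      by (rule sum.reindex_bij_witness[of _ Abs_poly_mapping Poly_Mapping.lookup])
        (auto simp: lookup_Abs h_def lookup_inverse)
    also have "\<dots> = 0"
      using assms(2)[OF \<open>a \<in> A\<close>] by (simp add: B_def)
    finally show "a \<in> zero_set P"
      by (simp add: zero_set_def)
  qed
  ultimately show False
    using assms(1) unfolding nondegenerate_def by blast
qed

text \<open>Were there no such weights, the alternative would give a \<open>w\<close> orthogonal to
  all evaluations on \<open>A\<close> with \<open>w \<alpha>\<close> nonzero, against the previous
  lemma.\<close>

lemma nondegenerate_dual_weights:
  fixes A :: "('a::field ^ 'n::finite) set"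
  assumes "nondegenerate A d" and "finite A" and "sum \<alpha> UNIV \<le> d"
  obtains c where "\<And>\<beta>. sum \<beta> UNIV \<le> d \<Longrightarrow>
    (\<Sum>a\<in>A. c a * monomial_fun \<beta> a) = (if \<beta> = \<alpha> then 1 else 0)"
proof -
  let ?B = "{\<beta> :: 'n \<Rightarrow> nat. sum \<beta> UNIV \<le> d}"
  let ?e = "\<lambda>\<beta>. if \<beta> = \<alpha> then 1 else 0 :: 'a"
  have "\<not> (\<exists>w. (\<forall>a\<in>A. (\<Sum>\<beta>\<in>?B. monomial_fun \<beta> a * w \<beta>) = 0) \<and> (\<Sum>\<beta>\<in>?B. ?e \<beta> * w \<beta>) \<noteq> 0)"
    using nondegenerate_combination_eq_0[OF assms(1)] by (force intro: sum.neutral)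
  with finite_linear_alternative[OF assms(2) finite_exponents_le[of d],
      where M = "\<lambda>a \<beta>. monomial_fun \<beta> a" and e = ?e]
  obtain c where "\<forall>\<beta>\<in>?B. (\<Sum>a\<in>A. c a * monomial_fun \<beta> a) = ?e \<beta>"
    by blast
  then show ?thesis
    by (intro that[of c]) simp
qed

text \<open>Because \<open>\<alpha>\<close> has degree exactly \<open>d\<close>, the weights kill
  every monomial of degree below \<open>d\<close>; this is what makes averaging lower degrees by
  \<open>d\<close>.\<close>

locale dual_weights =
  fixes A :: "('a::field ^ 'n::finite) set" and d :: nat and \<alpha> :: "'n \<Rightarrow> nat"
    and c :: "'a ^ 'n \<Rightarrow> 'a"
  assumes degree_\<alpha>: "sum \<alpha> UNIV = d"
    and weights: "\<And>\<beta>. sum \<beta> UNIV \<le> d \<Longrightarrow>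
      (\<Sum>a\<in>A. c a * monomial_fun \<beta> a) = (if \<beta> = \<alpha> then 1 else 0)"
begin

definition average :: "('a ^ 'n \<Rightarrow> 'a) \<Rightarrow> 'a ^ 'n \<Rightarrow> 'a" where
  "average f x = (\<Sum>a\<in>A. c a * f (x + a))"

lemma average_linear: "average (\<lambda>x. r * f x + g x) = (\<lambda>x. r * average f x + average g x)"
  by (simp add: fun_eq_iff average_def algebra_simps sum.distrib sum_distrib_left)

lemma average_monomial:
  "average (monomial_fun \<gamma>) x =
     (\<Sum>\<beta>\<in>PiE UNIV (\<lambda>j. {..\<gamma> j}).
        of_nat (\<Prod>j\<in>UNIV. \<gamma> j choose \<beta> j) * (\<Sum>a\<in>A. c a * monomial_fun \<beta> a) *
        monomial_fun (\<lambda>j. \<gamma> j - \<beta> j) x)"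
proof -
  have "average (monomial_fun \<gamma>) x =
      (\<Sum>a\<in>A. \<Sum>\<beta>\<in>PiE UNIV (\<lambda>j. {..\<gamma> j}). c a * (of_nat (\<Prod>j\<in>UNIV. \<gamma> j choose \<beta> j) *
        monomial_fun \<beta> a * monomial_fun (\<lambda>j. \<gamma> j - \<beta> j) x))"
    unfolding average_def monomial_fun_add sum_distrib_left ..
  also have "\<dots> = (\<Sum>\<beta>\<in>PiE UNIV (\<lambda>j. {..\<gamma> j}).
      \<Sum>a\<in>A. c a * (of_nat (\<Prod>j\<in>UNIV. \<gamma> j choose \<beta> j) *
        monomial_fun \<beta> a * monomial_fun (\<lambda>j. \<gamma> j - \<beta> j) x))"
    by (rule sum.swap)
  finally show ?thesis
    by (simp add: sum_distrib_left sum_distrib_right mult_ac)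
qed

text \<open>In the expansion of a monomial, \<open>\<beta>\<close> of degree below \<open>d\<close>
  has weighted sum \<open>0\<close>, and any other \<open>\<beta>\<close> removes at least
  \<open>d\<close> from the degree. For \<open>k \<le> d\<close> the average is therefore zero, in
  line with truncated subtraction.\<close>

lemma average_low_degree:
  "f \<in> low_degree k \<Longrightarrow> average f \<in> low_degree (k - d)"
proof (induction rule: low_degree.induct)
  case zero
  show ?case by (simp add: average_def[abs_def] low_degree.zero)
next
  case (add_monomial f \<gamma> r)
  have "average (monomial_fun \<gamma>) \<in> low_degree (k - d)"
    unfolding average_monomial[abs_def]
  proof (rule low_degree_sum)
    fix \<beta> assume \<beta>: "\<beta> \<in> PiE UNIV (\<lambda>j. {..\<gamma> j})"
    let ?r = "of_nat (\<Prod>j\<in>UNIV. \<gamma> j choose \<beta> j) * (\<Sum>a\<in>A. c a * monomial_fun \<beta> a)"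
    show "(\<lambda>x. ?r * monomial_fun (\<lambda>j. \<gamma> j - \<beta> j) x) \<in> low_degree (k - d)"
    proof (cases "sum \<beta> UNIV < d")
      case True
      then have "?r = 0" using degree_\<alpha> by (auto simp: weights)
      then show ?thesis by (simp only: mult_zero_left low_degree.zero)
    next
      case False
      then show ?thesis
        using sum_diff_exponent[OF \<beta>] add_monomial.hyps(2) by (intro low_degree_monomial) simp
    qed
  qed
  then show ?case
    using add_monomial.IH by (simp add: average_linear low_degree_add low_degree_cmult)
qed

lemma average_leading_term:
  assumes "\<And>j. \<alpha> j \<le> \<gamma> j"
  obtains f where "f \<in> low_degree (sum \<gamma> UNIV - d)"
    and "average (monomial_fun \<gamma>) =
      (\<lambda>x. of_nat (\<Prod>j\<in>UNIV. \<gamma> j choose \<alpha> j) * monomial_fun (\<lambda>j. \<gamma> j - \<alpha> j) x + f x)"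
proof
  let ?B = "PiE UNIV (\<lambda>j. {..\<gamma> j})"
  let ?r = "\<lambda>\<beta>. of_nat (\<Prod>j\<in>UNIV. \<gamma> j choose \<beta> j) * (\<Sum>a\<in>A. c a * monomial_fun \<beta> a)"
  let ?f = "\<lambda>x. \<Sum>\<beta>\<in>?B - {\<alpha>}. ?r \<beta> * monomial_fun (\<lambda>j. \<gamma> j - \<beta> j) x"
  have "finite ?B" by (intro finite_PiE) auto
  moreover have "\<alpha> \<in> ?B" using assms by auto
  moreover have "?r \<alpha> = of_nat (\<Prod>j\<in>UNIV. \<gamma> j choose \<alpha> j)"
    using weights[of \<alpha>] degree_\<alpha> by simp
  ultimately show "average (monomial_fun \<gamma>) =
      (\<lambda>x. of_nat (\<Prod>j\<in>UNIV. \<gamma> j choose \<alpha> j) * monomial_fun (\<lambda>j. \<gamma> j - \<alpha> j) x + ?f x)"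
    by (simp only: average_monomial[abs_def] sum.remove)
  show "?f \<in> low_degree (sum \<gamma> UNIV - d)"
  proof (rule low_degree_sum)
    fix \<beta> assume \<beta>: "\<beta> \<in> ?B - {\<alpha>}"
    show "(\<lambda>x. ?r \<beta> * monomial_fun (\<lambda>j. \<gamma> j - \<beta> j) x) \<in> low_degree (sum \<gamma> UNIV - d)"
    \<comment> \<open>With \<open>\<alpha>\<close> taken out, degree \<open>d\<close> itself also
      contributes nothing, so the surviving terms lie strictly below the leading one.\<close>
    proof (cases "sum \<beta> UNIV \<le> d")
      case True
      then have "?r \<beta> = 0" using \<beta> by (auto simp: weights)
      then show ?thesis by (simp only: mult_zero_left low_degree.zero)
    next
      case False
      then show ?thesis
        using sum_diff_exponent[of \<beta> \<gamma>] \<beta> by (intro low_degree_monomial) auto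
    qed
  qed
qed

end

section \<open>Covering by sumsets\<close>

text \<open>The binomial coefficient divides \<open>fact n\<close>, which is prime to the
  characteristic.\<close>

lemma of_nat_choose_mod_ring_neq_0:
  assumes "k \<le> n" and "n < CARD('p::prime_card)"
  shows "(of_nat (n choose k) :: 'p::prime_card mod_ring) \<noteq> 0"
proof
  assume "(of_nat (n choose k) :: 'p mod_ring) = 0"
  then have "CARD('p) dvd n choose k"
    by (rule of_nat_0_mod_ring_dvd)
  then have "CARD('p) dvd fact n"
    by (metis assms(1) binomial_fact_lemma dvd_mult)
  then show False
    using assms(2) prime_card prime_dvd_fact_iff by (metis not_less)
qed

text \<open>Supplies the order of the divided derivative; units are added one at a time wherever
  \<open>\<gamma>\<close> leaves room.\<close>

lemma exists_exponent_below:
  fixes \<gamma> :: "'n::finite \<Rightarrow> nat"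
  assumes "d \<le> sum \<gamma> UNIV"
  obtains \<alpha> where "\<And>j. \<alpha> j \<le> \<gamma> j" "sum \<alpha> UNIV = d"
proof -
  have "\<exists>\<alpha>. (\<forall>j. \<alpha> j \<le> \<gamma> j) \<and> sum \<alpha> UNIV = d"
    using assms
  proof (induction d)
    case 0
    show ?case by (intro exI[of _ "\<lambda>_. 0"]) auto
  next
    case (Suc d)
    then obtain \<alpha> where \<alpha>: "\<forall>j. \<alpha> j \<le> \<gamma> j" "sum \<alpha> UNIV = d" by auto
    have "\<exists>j. \<alpha> j < \<gamma> j"
    proof (rule ccontr)
      assume "\<not> (\<exists>j. \<alpha> j < \<gamma> j)"
      then have "sum \<gamma> UNIV \<le> sum \<alpha> UNIV" by (intro sum_mono) (simp add: not_less)
      then show False using Suc.prems \<alpha> by simp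
    qed
    then obtain i where i: "\<alpha> i < \<gamma> i" by blast
    have "sum (\<alpha>(i := Suc (\<alpha> i))) UNIV = Suc (\<alpha> i) + sum \<alpha> (UNIV - {i})"
      by (subst sum.remove[of _ i]) auto
    also have "\<dots> = Suc d"
      using \<alpha>(2) by (subst (asm) sum.remove[of _ i]) auto
    finally show ?case
      using \<alpha> i by (intro exI[of _ "\<alpha>(i := Suc (\<alpha> i))"]) auto
  qed
  then show ?thesis using that by blast
qed

text \<open>Each averaging step preserves the shape "nonzero leading monomial plus lower terms", so
  induction on \<open>I\<close> applies with \<open>\<gamma>\<close>, \<open>r\<close> and
  \<open>f\<close> arbitrary.\<close>

lemma leading_term_nonvanishing_on_sumset:
  fixes A :: "'i \<Rightarrow> ('p::prime_card mod_ring ^ 'n::finite) set"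
  assumes "finite I" and "\<And>i. i \<in> I \<Longrightarrow> nondegenerate (A i) (d i)"
    and "sum \<gamma> UNIV \<le> (\<Sum>i\<in>I. d i)" and "\<And>j. \<gamma> j < CARD('p)"
    and "r \<noteq> 0" and "f \<in> low_degree (sum \<gamma> UNIV)"
  shows "\<exists>s\<in>\<Sum>i\<in>I. A i. r * monomial_fun \<gamma> (u + s) + f (u + s) \<noteq> 0"
  using assms
proof (induction I arbitrary: \<gamma> r f rule: finite_induct)
  case empty
  \<comment> \<open>No degree is left: \<open>f\<close> vanishes and the value is the constant
    \<open>r\<close>.\<close>
  then have "\<gamma> = (\<lambda>_. 0)" by auto
  with empty show ?case
    by (auto simp: monomial_fun_def low_degree_0)
next
  case (insert i I)
  \<comment> \<open>The minimum guarantees an exponent of degree \<open>k\<close> below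
    \<open>\<gamma>\<close> even when \<open>d i\<close> exceeds the degree still left.\<close>
  define k where "k = min (d i) (sum \<gamma> UNIV)"
  have "nondegenerate (A i) k"
    using insert.prems(1) by (rule nondegenerate_mono[of _ "d i"]) (auto simp: k_def)
  obtain \<alpha> where \<alpha>: "\<And>j. \<alpha> j \<le> \<gamma> j" "sum \<alpha> UNIV = k"
    using exists_exponent_below[of k \<gamma>] by (auto simp: k_def)
  obtain c where c: "\<And>\<beta>. sum \<beta> UNIV \<le> k \<Longrightarrow>
      (\<Sum>a\<in>A i. c a * monomial_fun \<beta> a) = (if \<beta> = \<alpha> then 1 else 0)"
    \<comment> \<open>\<open>A i\<close> is finite because the whole space is.\<close>
    using nondegenerate_dual_weights[OF \<open>nondegenerate (A i) k\<close>, of \<alpha>] \<alpha>(2) by auto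
  interpret dual_weights "A i" k \<alpha> c
    by unfold_locales (use \<alpha> c in auto)
  define \<gamma>' where "\<gamma>' = (\<lambda>j. \<gamma> j - \<alpha> j)"
  define b where "b = (of_nat (\<Prod>j\<in>UNIV. \<gamma> j choose \<alpha> j) :: 'p mod_ring)"
  have sum_\<gamma>': "sum \<gamma>' UNIV = sum \<gamma> UNIV - k"
    using \<alpha> by (simp add: \<gamma>'_def sum_subtractf_nat)
  obtain h where h: "h \<in> low_degree (sum \<gamma>' UNIV)"
    and lead: "average (monomial_fun \<gamma>) = (\<lambda>x. b * monomial_fun \<gamma>' x + h x)"
    using average_leading_term[of \<gamma>, OF \<alpha>(1), folded b_def \<gamma>'_def sum_\<gamma>'] by blast
  let ?g = "\<lambda>x. r * monomial_fun \<gamma> x + f x"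
  have avg: "average ?g = (\<lambda>x. (r * b) * monomial_fun \<gamma>' x + (r * h x + average f x))"
    unfolding average_linear lead by (simp add: algebra_simps)
  have "\<exists>s\<in>\<Sum>i\<in>I. A i. (r * b) * monomial_fun \<gamma>' (u + s) + (r * h (u + s) + average f (u + s)) \<noteq> 0"
  proof (rule insert.IH)
    show "nondegenerate (A i) (d i)" if "i \<in> I" for i
      using insert.prems(1) that by simp
    show "sum \<gamma>' UNIV \<le> sum d I"
      using insert.prems(2) insert.hyps by (simp add: sum_\<gamma>' k_def)
    show "\<gamma>' j < CARD('p)" for j
      using insert.prems(3)[of j] by (simp add: \<gamma>'_def)
    have "b \<noteq> 0"
      using of_nat_choose_mod_ring_neq_0[OF \<alpha>(1) insert.prems(3)] by (simp add: b_def)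
    then show "r * b \<noteq> 0"
      using insert.prems(4) by simp
    show "(\<lambda>x. r * h x + average f x) \<in> low_degree (sum \<gamma>' UNIV)"
      using average_low_degree[OF insert.prems(5)] h
      by (simp add: low_degree_add low_degree_cmult sum_\<gamma>')
  qed
  then obtain s where s: "s \<in> (\<Sum>i\<in>I. A i)" "average ?g (u + s) \<noteq> 0"
    unfolding avg by blast
  \<comment> \<open>A nonzero weighted sum has a nonzero term.\<close>
  then obtain a where a: "a \<in> A i" "?g (u + s + a) \<noteq> 0"
    unfolding average_def by (metis (no_types, lifting) mult_zero_right sum.neutral)
  have "a + s \<in> (\<Sum>i\<in>insert i I. A i)"
    using insert.hyps a s by (simp add: set_plus_intro)
  moreover have "u + s + a = u + (a + s)"
    by (simp add: algebra_simps)
  ultimately show ?case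
    using a by metis
qed

text \<open>Expands the product of the factors \<open>1 - x_j^(p-1)\<close> over subsets
  \<open>S\<close> of the coordinates: \<open>S = UNIV\<close> gives the leading monomial, proper
  subsets give \<open>f\<close>.\<close>

lemma indicator_origin_polynomial:
  fixes \<gamma> :: "'n::finite \<Rightarrow> nat"
  defines "\<gamma> \<equiv> \<lambda>_. CARD('p::prime_card) - 1"
  obtains f :: "'p::prime_card mod_ring ^ 'n::finite \<Rightarrow> 'p mod_ring" where "f \<in> low_degree (sum \<gamma> UNIV)"
    and "\<And>x. (- 1) ^ CARD('n) * monomial_fun \<gamma> x + f x \<noteq> 0 \<Longrightarrow> x = 0"
proof
  let ?p = "CARD('p)"
  let ?\<beta> = "\<lambda>S j. if j \<in> S then ?p - 1 else 0"
  let ?f = "\<lambda>x :: 'p mod_ring ^ 'n. \<Sum>S\<in>Pow UNIV - {UNIV}. (- 1) ^ card S * monomial_fun (?\<beta> S) x"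
  have p: "1 < ?p"
    using prime_card prime_gt_1_nat by blast
  show "?f \<in> low_degree (sum \<gamma> UNIV)"
  proof (rule low_degree_sum)
    fix S :: "'n set" assume S: "S \<in> Pow UNIV - {UNIV}"
    then obtain j where "j \<notin> S" by auto
    then have "sum (?\<beta> S) UNIV < sum \<gamma> UNIV"
      using p by (intro sum_strict_mono_ex1) (auto simp: \<gamma>_def)
    then show "(\<lambda>x. (- 1) ^ card S * monomial_fun (?\<beta> S) x) \<in> low_degree (sum \<gamma> UNIV)"
      by (rule low_degree_monomial)
  qed
  fix x :: "'p mod_ring ^ 'n"
  assume nz: "(- 1) ^ CARD('n) * monomial_fun \<gamma> x + ?f x \<noteq> 0"
  have "(\<Prod>j\<in>UNIV. - ((x $ j) ^ (?p - 1)) + 1) =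
      (\<Sum>S\<in>Pow UNIV. (\<Prod>j\<in>S. - ((x $ j) ^ (?p - 1))) * (\<Prod>j\<in>UNIV - S. 1))"
    by (rule prod_add) simp
  also have "\<dots> = (\<Sum>S\<in>Pow UNIV. (- 1) ^ card S * monomial_fun (?\<beta> S) x)"
  proof (rule sum.cong)
    fix S :: "'n set"
    have "monomial_fun (?\<beta> S) x = (\<Prod>j\<in>UNIV. if j \<in> S then (x $ j) ^ (?p - 1) else 1)"
      unfolding monomial_fun_def by (intro prod.cong) auto
    also have "\<dots> = (\<Prod>j\<in>S. (x $ j) ^ (?p - 1))"
      by (simp add: prod.If_cases)
    finally show "(\<Prod>j\<in>S. - ((x $ j) ^ (?p - 1))) * (\<Prod>j\<in>UNIV - S. 1) =
        (- 1) ^ card S * monomial_fun (?\<beta> S) x"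
      by (simp add: prod_uminus)
  qed simp
  also have "\<dots> = (- 1) ^ CARD('n) * monomial_fun \<gamma> x + ?f x"
    by (subst sum.remove[of _ UNIV]) (auto simp: \<gamma>_def)
  finally have prod_nz: "(\<Prod>j\<in>UNIV. - ((x $ j) ^ (?p - 1)) + 1) \<noteq> 0"
    using nz by simp
  show "x = 0"
  proof (rule ccontr)
    assume "x \<noteq> 0"
    then obtain j where j: "x $ j \<noteq> 0" by (auto simp: Finite_Cartesian_Product.vec_eq_iff)
    \<comment> \<open>Fermat's little theorem; cancelling the nonzero coordinate makes the factor at
      \<open>j\<close> zero.\<close>
    have "(x $ j) ^ (?p - 1) * x $ j = 1 * x $ j"
      using fermat_theorem_mod_ring[of "x $ j"] p by (simp flip: power_Suc2)
    then have "(x $ j) ^ (?p - 1) = 1"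
      using j by simp
    then show False using prod_nz by auto
  qed
qed

theorem theorem1p1:
  fixes m :: nat
    and d :: "nat \<Rightarrow> nat"
    and A :: "nat \<Rightarrow> ('p::prime_card mod_ring ^ 'n::finite) set"
  assumes "m > 0"
    and "\<forall>i\<in>{1..m}. d i > 0"
    and "(\<Sum>i=1..m. d i) \<ge> (CARD('p) - 1) * CARD('n)"
    and "\<forall>i\<in>{1..m}. \<not> (\<exists>P :: ('n, 'p mod_ring) mpoly.
           P \<noteq> 0 \<and> mpoly_degree P \<le> d i \<and> A i \<subseteq> zero_set P)"
  shows "(\<Sum>i=1..m. A i) = UNIV"
proof -
  let ?\<gamma> = "\<lambda>_ :: 'n. CARD('p) - 1"
  obtain f :: "'p mod_ring ^ 'n \<Rightarrow> 'p mod_ring" where f: "f \<in> low_degree (sum ?\<gamma> UNIV)"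
    "\<And>x. (- 1) ^ CARD('n) * monomial_fun ?\<gamma> x + f x \<noteq> 0 \<Longrightarrow> x = 0"
    using indicator_origin_polynomial by blast
  have "t \<in> (\<Sum>i=1..m. A i)" for t
  proof -
    \<comment> \<open>Shifting by \<open>- t\<close> moves the indicator to \<open>t\<close>, so a
      sumset element \<open>s\<close> where it is nonzero must equal \<open>t\<close>.\<close>
    have "\<exists>s\<in>\<Sum>i=1..m. A i. (- 1) ^ CARD('n) * monomial_fun ?\<gamma> (- t + s) + f (- t + s) \<noteq> 0"
    proof (rule leading_term_nonvanishing_on_sumset)
      show "nondegenerate (A i) (d i)" if "i \<in> {1..m}" for i
        using assms(4) that unfolding nondegenerate_def by blast
      show "sum ?\<gamma> UNIV \<le> (\<Sum>i=1..m. d i)"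
        using assms(3) by (simp add: mult.commute)
    qed (use f in auto)
    then obtain s where "s \<in> (\<Sum>i=1..m. A i)" "- t + s = 0"
      using f(2) by blast
    then show ?thesis by (metis add.inverse_inverse minus_unique)
  qed
  then show ?thesis by blast
qed

end
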